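(* Let $B=B(F_n)$ be a (standard or generalized) Bratteli diagram and let $\widetilde B=\widetilde B(\widetilde F_n)$ be its canonical image under the $0$-$1$ procedure. Let $(r_n)_{n\in\mathbb N_0}$ and $(c_n)_{n\in\mathbb N_0}$ be sequences of positive integers. Then: \begin{enumerate} \item[(i)] If $B$ has the $ERS(r_n)$ (respectively $ECS(c_n)$) property, then $\widetilde B$ has the $ERS(r_n)$ (respectively $ECS(c_{n+1})$) property. \item[(ii)] If $B$ is stationary, then $\widetilde B$ is stationary. \item[(iii)] If $B$ is a horizontally stationary generalized Bratteli diagram with the $ERS(r_n)$ property, then $\widetilde B$ is not horizontally stationary. \end{enumerate}
   Context: A generalized Bratteli diagram is a graded graph $B=(V,E)$, $V=\bigsqcup_{n\ge0}V_n$, $E=\bigsqcup_{n\ge0}E_n$, with each $V_n$ countably infinite and each $E_n$ countable; every $e\in E_n$ has a source $s(e)\in V_n$ and a range $r(e)\in V_{n+1}$; $s^{-1}(v)\ne\emptyset$ for all $v\in V$; $r^{-1}(v)$ is nonempty and finite for $v\in V\setminus V_0$. Standard: all $V_n$ finite instead. The incidence matrix $F_n=(f^{(n)}_{v,w})_{v\in V_{n+1},w\in V_n}$ counts edges from $w$ to $v$. The space of infinite paths (infinite sequences of composable edges from level $0$, with the cylinder topology) is assumed to have no isolated points. $B$ is stationary if $F_n$ does not depend on $n$. $ERS(r_n)$: $\sum_{w\in V_n}f^{(n)}_{v,w}=r_n$ for all $n$, $v\in V_{n+1}$. $ECS(c_n)$: $\sum_{v\in V_{n+1}}f^{(n)}_{v,w}=c_n$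 for all $n$, $w\in V_n$. Horizontally stationary: $V_n=\mathbb Z$ for all $n$ and $f^{(n)}_{i,j}=f^{(n)}_{i+1,j+1}$ for all $n$, $i\in V_{n+1}$, $j\in V_n$. $0$-$1$ procedure: $\widetilde B=(\widetilde V,\widetilde E)$ has $\widetilde V_n$ in bijection with $E_n$; vertices $\widetilde v\in\widetilde V_{n+1}$ and $\widetilde w\in\widetilde V_n$ corresponding to edges $e'\in E_{n+1}$, $e\in E_n$ are joined by exactly one edge if $s(e')=r(e)$ and by none otherwise. Canonical image: $\widetilde V_n$ is identified with a set of integers by enumerating $E_n$ as follows. The vertices of each level are identified with an initial segment of $\mathbb N_0$, with $\mathbb N_0$, or with $\mathbb Z$. For $l\ge0$ in $V_{n+1}$, the edges of $r^{-1}(l)$ are numbered from left to right (in order of their sources) by $\sum_{i=0}^{l-1}|r^{-1}(i)|,\dots,\sum_{i=0}^{l}|r^{-1}(i)|-1$; in the case of $\mathbb Z$, for $l>0$ the edges of $r^{-1}(-l)$ are numbered from left to right by $-\sum_{i=1}^{l}|r^{-1}(-i)|,\dots,-\sum_{i=1}^{l-1}|r^{-1}(-i)|-1$. *)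

theory Defs
  imports "HOL-Analysis.Analysis"
begin

text \<open>
  The vertex sets and edge sets are given level by level, so the disjointness of the unions
  over all levels is built in: the vertices of the diagram are the pairs consisting of a level
  \<open>n\<close> and an element of \<open>verts B n\<close>. The vertices of every level are already identified with
  integers, see \<open>index_set\<close> below.
\<close>

record 'e bratteli =
  verts :: "nat \<Rightarrow> int set"
  edges :: "nat \<Rightarrow> 'e set"
  src :: "nat \<Rightarrow> 'e \<Rightarrow> int"
  rng :: "nat \<Rightarrow> 'e \<Rightarrow> int"

definition out_edges :: "'e bratteli \<Rightarrow> nat \<Rightarrow> int \<Rightarrow> 'e set" where
  "out_edges B n w = {e \<in> edges B n. src B n e = w}"

text \<open>\<open>in_edges B n v\<close> is the set of edges with range \<open>v\<close>, where \<open>v\<close> is a vertex of level \<open>n + 1\<close>.\<close>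

definition in_edges :: "'e bratteli \<Rightarrow> nat \<Rightarrow> int \<Rightarrow> 'e set" where
  "in_edges B n v = {e \<in> edges B n. rng B n e = v}"

definition incidence :: "'e bratteli \<Rightarrow> nat \<Rightarrow> int \<Rightarrow> int \<Rightarrow> nat" where
  "incidence B n v w = card {e \<in> edges B n. src B n e = w \<and> rng B n e = v}"

definition paths :: "'e bratteli \<Rightarrow> (nat \<Rightarrow> 'e) set" where
  "paths B = {x. \<forall>n. x n \<in> edges B n \<and> rng B n (x n) = src B (Suc n) (x (Suc n))}"

definition cylinder :: "'e bratteli \<Rightarrow> nat \<Rightarrow> (nat \<Rightarrow> 'e) \<Rightarrow> (nat \<Rightarrow> 'e) set" where
  "cylinder B n x = {y \<in> paths B. \<forall>i<n. y i = x i}"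

definition path_topology :: "'e bratteli \<Rightarrow> (nat \<Rightarrow> 'e) topology" where
  "path_topology B = topology_generated_by {cylinder B n x | n x. x \<in> paths B}"

text \<open>
  An initial segment of the natural numbers, all natural numbers, or all integers.
\<close>

definition index_set :: "int set \<Rightarrow> bool" where
  "index_set X \<longleftrightarrow> (\<exists>k::nat. X = {0..<int k}) \<or> X = {0..} \<or> X = UNIV"

definition bratteli_graph :: "'e bratteli \<Rightarrow> bool" where
  "bratteli_graph B \<longleftrightarrow>
     (\<forall>n. index_set (verts B n)) \<and>
     (\<forall>n. countable (edges B n)) \<and>
     (\<forall>n. \<forall>e\<in>edges B n. src B n e \<in> verts B n \<and> rng B n e \<in> verts B (Suc n)) \<and>
     (\<forall>n. \<forall>w\<in>verts B n. out_edges B n w \<noteq> {}) \<and>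
     (\<forall>n. \<forall>v\<in>verts B (Suc n). in_edges B n v \<noteq> {} \<and> finite (in_edges B n v)) \<and>
     (\<forall>x\<in>topspace (path_topology B). \<not> openin (path_topology B) {x})"

definition generalized_bratteli :: "'e bratteli \<Rightarrow> bool" where
  "generalized_bratteli B \<longleftrightarrow> bratteli_graph B \<and> (\<forall>n. infinite (verts B n))"

definition standard_bratteli :: "'e bratteli \<Rightarrow> bool" where
  "standard_bratteli B \<longleftrightarrow> bratteli_graph B \<and> (\<forall>n. finite (verts B n))"

text \<open>
  The row and column sums may have infinitely many terms; they are unconditional sums in the
  discrete space of natural numbers, so only finitely many terms are nonzero.
\<close>

definition ERS :: "'e bratteli \<Rightarrow> (nat \<Rightarrow> nat) \<Rightarrow> bool" where
  "ERS B r \<longleftrightarrow>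
     (\<forall>n. \<forall>v\<in>verts B (Suc n). ((\<lambda>w. incidence B n v w) has_sum r n) (verts B n))"

definition ECS :: "'e bratteli \<Rightarrow> (nat \<Rightarrow> nat) \<Rightarrow> bool" where
  "ECS B c \<longleftrightarrow>
     (\<forall>n. \<forall>w\<in>verts B n. ((\<lambda>v. incidence B n v w) has_sum c n) (verts B (Suc n)))"

text \<open>Equality of the matrices includes equality of their row and column index sets.\<close>

definition stationary :: "'e bratteli \<Rightarrow> bool" where
  "stationary B \<longleftrightarrow>
     (\<forall>m n. verts B m = verts B n \<and>
        (\<forall>v\<in>verts B (Suc n). \<forall>w\<in>verts B n. incidence B m v w = incidence B n v w))"

definition horizontally_stationary :: "'e bratteli \<Rightarrow> bool" where
  "horizontally_stationary B \<longleftrightarrow>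
     (\<forall>n. verts B n = UNIV) \<and>
     (\<forall>n i j. incidence B n i j = incidence B n (i + 1) (j + 1))"

text \<open>The first and the last number given to the edges with range \<open>l\<close>.\<close>

definition first_num :: "'e bratteli \<Rightarrow> nat \<Rightarrow> int \<Rightarrow> int" where
  "first_num B n l =
     (if 0 \<le> l then (\<Sum>i\<in>{0..l - 1}. int (card (in_edges B n i)))
      else - (\<Sum>i\<in>{1..- l}. int (card (in_edges B n (- i)))))"

definition last_num :: "'e bratteli \<Rightarrow> nat \<Rightarrow> int \<Rightarrow> int" where
  "last_num B n l =
     (if 0 \<le> l then (\<Sum>i\<in>{0..l}. int (card (in_edges B n i))) - 1
      else - (\<Sum>i\<in>{1..- l - 1}. int (card (in_edges B n (- i)))) - 1)"

text \<open>
  Numbering edges from left to right leaves the order among parallel edges open, so this is a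
  predicate on numberings of the edge sets and not a function of the diagram.
\<close>

definition canonical_numbering :: "'e bratteli \<Rightarrow> (nat \<Rightarrow> 'e \<Rightarrow> int) \<Rightarrow> bool" where
  "canonical_numbering B num \<longleftrightarrow>
     (\<forall>n. \<forall>l\<in>verts B (Suc n).
        bij_betw (num n) (in_edges B n l) {first_num B n l..last_num B n l} \<and>
        (\<forall>e\<in>in_edges B n l. \<forall>e'\<in>in_edges B n l.
           src B n e < src B n e' \<longrightarrow> num n e < num n e'))"

text \<open>
  The image under the 0-1 procedure, with the vertices of level \<open>n\<close> labelled by the numbers of
  the edges in \<open>edges B n\<close>. The single edge that joins the vertices given by composable edges
  \<open>e\<close> and \<open>e'\<close> is the pair \<open>(e, e')\<close>.
\<close>

definition canonical_image ::
    "'e bratteli \<Rightarrow> (nat \<Rightarrow> 'e \<Rightarrow> int) \<Rightarrow> ('e \<times> 'e) bratteli" where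
  "canonical_image B num =
     \<lparr>verts = (\<lambda>n. num n ` edges B n),
      edges = (\<lambda>n. {(e, e'). e \<in> edges B n \<and> e' \<in> edges B (Suc n) \<and>
                              src B (Suc n) e' = rng B n e}),
      src = (\<lambda>n p. num n (fst p)),
      rng = (\<lambda>n p. num (Suc n) (snd p))\<rparr>"

lemma ex_numbering_finite:
  fixes f :: "'e \<Rightarrow> int"
  assumes "finite A"
  shows "\<exists>g. bij_betw g A {a..a + int (card A) - 1} \<and>
             (\<forall>e\<in>A. \<forall>e'\<in>A. f e < f e' \<longrightarrow> g e < g e')"
  using assms
proof (induction A rule: finite_ranking_induct[where f = f])
  case empty
  then show ?case by (auto simp: bij_betw_def)
next
  case (insert x S)
  show ?case
  proof (cases "x \<in> S")
    case True
    then show ?thesis using insert.IH by (simp add: insert_absorb)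
  next
    case False
    from insert.IH obtain g where g: "bij_betw g S {a..a + int (card S) - 1}"
      "\<forall>e\<in>S. \<forall>e'\<in>S. f e < f e' \<longrightarrow> g e < g e'" by blast
    let ?g = "g(x := a + int (card S))"
    have b: "bij_betw ?g S {a..a + int (card S) - 1}"
      using g(1) False by (metis bij_betw_cong fun_upd_other)
    have "bij_betw ?g (S \<union> {x}) ({a..a + int (card S) - 1} \<union> {a + int (card S)})"
      by (rule bij_betw_combine[OF b]) (auto simp: bij_betw_def)
    moreover have "{a..a + int (card S) - 1} \<union> {a + int (card S)} = {a..a + int (card S)}"
      by auto
    ultimately have "bij_betw ?g (insert x S) {a..a + int (card (insert x S)) - 1}"
      using False insert.hyps(1) by simp
    moreover have "?g e < a + int (card S)" if "e \<in> S" for e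
      using bij_betw_apply[OF b that] by auto
    moreover have "?g e < ?g e'"
      if "e \<in> insert x S" "e' \<in> insert x S" "f e < f e'" for e e'
    proof -
      have "e \<in> S" using that insert.hyps(2)[of e'] by auto
      then show ?thesis
        using that g(2) False calculation(2)[of e] by (cases "e' = x") auto
    qed
    ultimately show ?thesis by blast
  qed
qed

lemma last_num_eq: "last_num B n l = first_num B n l + int (card (in_edges B n l)) - 1"
proof (cases "0 \<le> l")
  case True
  then have "{0..l} = insert l {0..l - 1}" by auto
  with True show ?thesis by (simp add: first_num_def last_num_def)
next
  case False
  then have "{1..- l} = insert (- l) {1..- l - 1}" by auto
  with False show ?thesis by (simp add: first_num_def last_num_def)
qed

lemma canonical_numbering_exists:
  assumes "bratteli_graph B"
  shows "\<exists>num. canonical_numbering B num"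
proof -
  have "\<forall>n l. \<exists>g. l \<in> verts B (Suc n) \<longrightarrow>
      bij_betw g (in_edges B n l) {first_num B n l..last_num B n l} \<and>
      (\<forall>e\<in>in_edges B n l. \<forall>e'\<in>in_edges B n l. src B n e < src B n e' \<longrightarrow> g e < g e')"
    using ex_numbering_finite assms unfolding bratteli_graph_def last_num_eq by metis
  then obtain g where g: "\<And>n l. l \<in> verts B (Suc n) \<Longrightarrow>
      bij_betw (g n l) (in_edges B n l) {first_num B n l..last_num B n l} \<and>
      (\<forall>e\<in>in_edges B n l. \<forall>e'\<in>in_edges B n l. src B n e < src B n e' \<longrightarrow> g n l e < g n l e')"
    by metis
  have "canonical_numbering B (\<lambda>n e. g n (rng B n e) e)"
    unfolding canonical_numbering_def
  proof (intro allI ballI conjI impI)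
    fix n l assume l: "l \<in> verts B (Suc n)"
    have "\<And>e. e \<in> in_edges B n l \<Longrightarrow> g n (rng B n e) e = g n l e"
      by (simp add: in_edges_def)
    then show "bij_betw (\<lambda>e. g n (rng B n e) e) (in_edges B n l)
        {first_num B n l..last_num B n l}"
      using g[OF l] bij_betw_cong[of "in_edges B n l" "\<lambda>e. g n (rng B n e) e" "g n l"] by blast
  next
    fix n l e e'
    assume "l \<in> verts B (Suc n)" "e \<in> in_edges B n l" "e' \<in> in_edges B n l"
      "src B n e < src B n e'"
    then show "g n (rng B n e) e < g n (rng B n e') e'"
      using g[of l n] by (simp add: in_edges_def)
  qed
  then show ?thesis by blast
qed

end

theory Submission
  imports Defs
begin

text \<open>
  The numbers given to the edges with range \<open>l\<close> form consecutive blocks, so the numbering is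
  injective, and the row (column) of \<open>canonical_image B num\<close> at an edge lists the edges entering
  its source (leaving its range). This gives (i). For (ii), the entries of a row of the incidence
  matrix determine the source of the edge at each position of a block. For (iii), the rows are
  indicators of blocks \<open>{r * s..<r * (s + 1)}\<close>, and such a block is mapped to another one by the
  shift by \<open>1\<close> only if \<open>r = 1\<close>; but if all row sums are \<open>1\<close>, no vertex has two outgoing edges and
  every path is isolated.
\<close>

section \<open>Row and column sums as cardinalities of edge sets\<close>

text \<open>Sums in the discrete space of naturals converge only if they are eventually constant, so
  a finite set of values already carries all of \<open>E\<close>. Finiteness of \<open>E\<close> is
  thus a conclusion, which matters for the possibly infinite sets \<open>out_edges\<close>.\<close>

lemma has_sum_card_fibres:
  assumes "g ` E \<subseteq> A" and fin: "\<And>w. w \<in> A \<Longrightarrow> finite {e \<in> E. g e = w}"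
  shows "((\<lambda>w. card {e \<in> E. g e = w}) has_sum s) A \<longleftrightarrow> finite E \<and> card E = s"
proof -
  have sum_eq: "(\<Sum>w\<in>X. card {e \<in> E. g e = w}) = card {e \<in> E. g e \<in> X}"
    if "finite X" "X \<subseteq> A" for X
  proof -
    have "{e \<in> E. g e \<in> X} = (\<Union>w\<in>X. {e \<in> E. g e = w})" by auto
    then show ?thesis
      using that fin by (subst card_UN_disjoint[symmetric]) auto
  qed
  show ?thesis
  proof
    assume "((\<lambda>w. card {e \<in> E. g e = w}) has_sum s) A"
    then obtain X where X: "finite X" "X \<subseteq> A" and
      eq: "\<And>Y. finite Y \<Longrightarrow> X \<subseteq> Y \<Longrightarrow> Y \<subseteq> A \<Longrightarrow> (\<Sum>w\<in>Y. card {e \<in> E. g e = w}) = s"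
      unfolding has_sum_def tendsto_discrete eventually_finite_subsets_at_top by metis
    have "g e \<in> X" if "e \<in> E" for e
    proof (rule ccontr)
      assume "g e \<notin> X"
      moreover have "g e \<in> A" using assms(1) that by auto
      \<comment> \<open>Enlarging \<open>X\<close> by \<open>g e\<close> leaves the sum at
        \<open>s\<close>, so the added term vanishes.\<close>
      ultimately have "card {e' \<in> E. g e' = g e} = 0"
        using eq[of X] eq[of "insert (g e) X"] X by auto
      then show False using fin[OF \<open>g e \<in> A\<close>] that by auto
    qed
    then have E: "E = {e \<in> E. g e \<in> X}" by auto
    also have "\<dots> = (\<Union>w\<in>X. {e \<in> E. g e = w})" by auto
    finally have "finite E" using X fin by (metis (no_types, lifting) finite_UN_I subsetD)
    then show "finite E \<and> card E = s" using eq[of X] sum_eq[of X] X E by simp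
  next
    assume E: "finite E \<and> card E = s"
    have "(\<Sum>w\<in>g ` E. card {e \<in> E. g e = w}) = s"
      using E sum_eq[of "g ` E"] assms(1) by (simp add: Collect_mem_eq[of E] cong: conj_cong)
    then have "((\<lambda>w. card {e \<in> E. g e = w}) has_sum s) (g ` E)"
      using E by (metis finite_imageI has_sum_finite)
    \<comment> \<open>Fibres over values of \<open>A\<close> outside the image of \<open>E\<close>
      are empty and contribute 0.\<close>
    then show "((\<lambda>w. card {e \<in> E. g e = w}) has_sum s) A"
      by (subst has_sum_cong_neutral[where T = "g ` E" and g = "\<lambda>w. card {e \<in> E. g e = w}"])
        (use assms(1) fin in \<open>auto simp: card_eq_0_iff\<close>)
  qed
qed

text \<open>Assumed are only facts that can be read off directly for
  \<open>canonical_image B num\<close> as well, so that the lemma serves both diagrams.\<close>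

lemma ERS_iff_card_in_edges:
  assumes "\<And>n e. e \<in> edges B n \<Longrightarrow> src B n e \<in> verts B n"
    and fin: "\<And>n v. v \<in> verts B (Suc n) \<Longrightarrow> finite (in_edges B n v)"
  shows "ERS B r \<longleftrightarrow> (\<forall>n. \<forall>v\<in>verts B (Suc n). card (in_edges B n v) = r n)"
proof -
  have "((\<lambda>w. incidence B n v w) has_sum r n) (verts B n) \<longleftrightarrow> card (in_edges B n v) = r n"
    if "v \<in> verts B (Suc n)" for n v
  proof -
    have "incidence B n v = (\<lambda>w. card {e \<in> in_edges B n v. src B n e = w})"
      by (auto simp: incidence_def in_edges_def fun_eq_iff intro!: arg_cong[where f = card])
    moreover have "((\<lambda>w. card {e \<in> in_edges B n v. src B n e = w}) has_sum r n) (verts B n) \<longleftrightarrow>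
        finite (in_edges B n v) \<and> card (in_edges B n v) = r n"
      using assms(1) by (intro has_sum_card_fibres rev_finite_subset[OF fin[OF that]])
        (auto simp: in_edges_def)
    ultimately show ?thesis using fin[OF that] by simp
  qed
  then show ?thesis by (simp add: ERS_def)
qed

lemma ECS_iff_card_out_edges:
  assumes "\<And>n e. e \<in> edges B n \<Longrightarrow> rng B n e \<in> verts B (Suc n)"
    and fin: "\<And>n v. v \<in> verts B (Suc n) \<Longrightarrow> finite (in_edges B n v)"
  shows "ECS B c \<longleftrightarrow>
    (\<forall>n. \<forall>w\<in>verts B n. finite (out_edges B n w) \<and> card (out_edges B n w) = c n)"
proof -
  have "((\<lambda>v. incidence B n v w) has_sum c n) (verts B (Suc n)) \<longleftrightarrow>
      finite (out_edges B n w) \<and> card (out_edges B n w) = c n" for n w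
  proof -
    have "(\<lambda>v. incidence B n v w) = (\<lambda>v. card {e \<in> out_edges B n w. rng B n e = v})"
      by (auto simp: incidence_def out_edges_def fun_eq_iff intro!: arg_cong[where f = card])
    moreover have "finite {e \<in> out_edges B n w. rng B n e = v}" if "v \<in> verts B (Suc n)" for v
      by (rule finite_subset[OF _ fin[OF that]]) (auto simp: out_edges_def in_edges_def)
    moreover have "rng B n ` out_edges B n w \<subseteq> verts B (Suc n)"
      using assms(1) by (auto simp: out_edges_def)
    ultimately show ?thesis by (simp add: has_sum_card_fibres)
  qed
  then show ?thesis by (simp add: ECS_def)
qed

section \<open>Uniqueness of sorted numberings\<close>

text \<open>Ties may be numbered in any order, so equal positions need not hold equal elements; only
  the sort keys agree. Exchanging the two numberings gives the reverse inequality.\<close>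

lemma ordered_numberings_agree:
  fixes f :: "'a \<Rightarrow> 'c::linorder" and f' :: "'b \<Rightarrow> 'c" and g :: "'a \<Rightarrow> int" and g' :: "'b \<Rightarrow> int"
  assumes g: "bij_betw g A {a..b}" and mono: "\<And>x y. x \<in> A \<Longrightarrow> y \<in> A \<Longrightarrow> f x < f y \<Longrightarrow> g x < g y"
    and g': "bij_betw g' A' {a..b}"
    and mono': "\<And>x y. x \<in> A' \<Longrightarrow> y \<in> A' \<Longrightarrow> f' x < f' y \<Longrightarrow> g' x < g' y"
    and fibres: "\<And>z. card {x \<in> A. f x = z} = card {x \<in> A'. f' x = z}"
    and e: "e \<in> A" "e' \<in> A'" "g e = g' e'"
  shows "f' e' \<le> f e"
proof (rule ccontr)
  \<comment> \<open>Otherwise fewer elements of \<open>A'\<close> than of \<open>A\<close> would have a value at most \<open>f e\<close>.\<close>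
  assume "\<not> f' e' \<le> f e"
  then have less: "f e < f' e'" by simp
  have fin: "finite A" "finite A'"
    using bij_betw_finite[OF g] bij_betw_finite[OF g'] by auto
  \<comment> \<open>The values of both functions are included, so that both counts become sums over
    the same finite set.\<close>
  let ?Z = "{z \<in> f ` A \<union> f' ` A'. z \<le> f e}"
  have A: "{x \<in> A. f x \<le> f e} = (\<Union>z\<in>?Z. {x \<in> A. f x = z})" by auto
  have A': "{x \<in> A'. f' x \<le> f e} = (\<Union>z\<in>?Z. {x \<in> A'. f' x = z})" by auto
  have "card {x \<in> A. f x \<le> f e} = (\<Sum>z\<in>?Z. card {x \<in> A. f x = z})"
    unfolding A using fin by (intro card_UN_disjoint) auto
  also have "\<dots> = (\<Sum>z\<in>?Z. card {x \<in> A'. f' x = z})" by (simp add: fibres)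
  also have "\<dots> = card {x \<in> A'. f' x \<le> f e}"
    unfolding A' using fin by (intro card_UN_disjoint[symmetric]) auto
  finally have eq: "card {x \<in> A. f x \<le> f e} = card {x \<in> A'. f' x \<le> f e}" .
  \<comment> \<open>By monotonicity no position up to \<open>g e\<close> can hold a value above
    \<open>f e\<close>.\<close>
  have "{a..g e} \<subseteq> g ` {x \<in> A. f x \<le> f e}"
  proof
    fix k assume k: "k \<in> {a..g e}"
    then have "k \<in> {a..b}" using bij_betw_apply[OF g e(1)] by auto
    then obtain x where "x \<in> A" "k = g x" using g unfolding bij_betw_def by blast
    then show "k \<in> g ` {x \<in> A. f x \<le> f e}" using k mono[OF e(1), of x] by fastforce
  qed
  then have "card {a..g e} \<le> card {x \<in> A. f x \<le> f e}" 
    by (rule surj_card_le[rotated]) (use fin in simp)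
  moreover have "card {x \<in> A'. f' x \<le> f e} \<le> card {a..<g' e'}"
  proof (rule card_inj_on_le)
    show "inj_on g' {x \<in> A'. f' x \<le> f e}"
      using g' by (auto simp: bij_betw_def intro: inj_on_subset)
    show "g' ` {x \<in> A'. f' x \<le> f e} \<subseteq> {a..<g' e'}"
    proof (intro image_subsetI)
      fix x assume x: "x \<in> {x \<in> A'. f' x \<le> f e}"
      then have "g' x < g' e'" using mono'[OF _ e(2), of x] less by auto
      then show "g' x \<in> {a..<g' e'}" using bij_betw_apply[OF g', of x] x by simp
    qed
  qed simp
  \<comment> \<open>Cardinalities of integer intervals truncate at 0; this bound makes
    \<open>{a..g e}\<close> strictly larger than \<open>{a..<g' e'}\<close>.\<close>
  moreover have "a \<le> g e" using bij_betw_apply[OF g e(1)] by simp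
  ultimately show False using eq e(3) by simp
qed

section \<open>Consecutive blocks of numbers\<close>

text \<open>The two branches of \<open>first_num\<close> obey one recursion over all integers, so
  the blocks are adjacent also across 0.\<close>

lemma first_num_add_one:
  "first_num B n (l + 1) = first_num B n l + int (card (in_edges B n l))"
proof (cases "0 \<le> l")
  case True
  then have "{0..l} = insert l {0..l - 1}" by auto
  with True show ?thesis by (simp add: first_num_def)
next
  case False
  \<comment> \<open>For \<open>l = -1\<close> the argument \<open>l + 1\<close> falls under the
    other branch; its sum is empty too.\<close>
  then have "{1..- l} = insert (- l) {1..- (l + 1)}" by auto
  with False show ?thesis by (auto simp: first_num_def)
qed

lemma first_num_mono: "l \<le> l' \<Longrightarrow> first_num B n l \<le> first_num B n l'"
  by (induction l' rule: int_ge_induct) (auto simp: first_num_add_one)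

lemma last_num_less_first_num: "l < l' \<Longrightarrow> last_num B n l < first_num B n l'"
  using first_num_mono[of "l + 1" l' B n] by (simp add: first_num_add_one last_num_eq)

section \<open>Injectivity of the numbering and the edges of the image\<close>

locale numbered_bratteli =
  fixes B :: "'e bratteli" and num :: "nat \<Rightarrow> 'e \<Rightarrow> int"
  assumes graph: "bratteli_graph B" and numbering: "canonical_numbering B num"
begin

lemma src_in_verts: "e \<in> edges B n \<Longrightarrow> src B n e \<in> verts B n"
  and rng_in_verts: "e \<in> edges B n \<Longrightarrow> rng B n e \<in> verts B (Suc n)"
  and finite_in_edges: "v \<in> verts B (Suc n) \<Longrightarrow> finite (in_edges B n v)"
  and in_edges_nonempty: "v \<in> verts B (Suc n) \<Longrightarrow> in_edges B n v \<noteq> {}"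
  and out_edges_nonempty: "w \<in> verts B n \<Longrightarrow> out_edges B n w \<noteq> {}"
  using graph by (auto simp: bratteli_graph_def)

lemma num_bij_betw:
  "v \<in> verts B (Suc n) \<Longrightarrow> bij_betw (num n) (in_edges B n v) {first_num B n v..last_num B n v}"
  and num_mono: "v \<in> verts B (Suc n) \<Longrightarrow> e \<in> in_edges B n v \<Longrightarrow> e' \<in> in_edges B n v \<Longrightarrow>
    src B n e < src B n e' \<Longrightarrow> num n e < num n e'"
  using numbering by (auto simp: canonical_numbering_def)

lemma num_in_block:
  assumes "e \<in> edges B n"
  shows "num n e \<in> {first_num B n (rng B n e)..last_num B n (rng B n e)}"
  using bij_betw_apply[OF num_bij_betw[OF rng_in_verts[OF assms]]] assms
  by (simp add: in_edges_def)

lemma block_eq: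
  assumes "k \<in> {first_num B n l..last_num B n l}" "k \<in> {first_num B n l'..last_num B n l'}"
  shows "l = l'"
  using assms last_num_less_first_num[of l l' B n] last_num_less_first_num[of l' l B n]
  by (cases l l' rule: linorder_cases) auto

text \<open>A number lies in only one block and so recovers the range; on the edges with that range
  the numbering is a bijection.\<close>

lemma inj_on_num: "inj_on (num n) (edges B n)"
proof
  fix e e' assume e: "e \<in> edges B n" "e' \<in> edges B n" and eq: "num n e = num n e'"
  have "rng B n e = rng B n e'"
    using num_in_block[OF e(1)] num_in_block[OF e(2)] block_eq eq by metis
  then show "e = e'"
    using e eq num_bij_betw[OF rng_in_verts[OF e(1)]] by (auto simp: bij_betw_def in_edges_def inj_on_def)
qed

lemma num_eq_iff:
  "e \<in> edges B n \<Longrightarrow> e' \<in> edges B n \<Longrightarrow> num n e = num n e' \<longleftrightarrow> e = e'"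
  using inj_on_num by (auto dest: inj_onD)

lemma incidence_canonical_image:
  assumes "e \<in> edges B n" "e' \<in> edges B (Suc n)"
  shows "incidence (canonical_image B num) n (num (Suc n) e') (num n e) =
    (if src B (Suc n) e' = rng B n e then 1 else 0)"
proof -
  have "{p \<in> edges (canonical_image B num) n. src (canonical_image B num) n p = num n e \<and>
      rng (canonical_image B num) n p = num (Suc n) e'} =
      (if src B (Suc n) e' = rng B n e then {(e, e')} else {})"
    using assms by (auto simp: canonical_image_def num_eq_iff)
  then show ?thesis by (simp add: incidence_def)
qed

lemma in_edges_canonical_image:
  assumes "e' \<in> edges B (Suc n)"
  shows "in_edges (canonical_image B num) n (num (Suc n) e') =
    (\<lambda>e. (e, e')) ` in_edges B n (src B (Suc n) e')"
  using assms by (auto simp: canonical_image_def in_edges_def num_eq_iff)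

lemma out_edges_canonical_image:
  assumes "e \<in> edges B n"
  shows "out_edges (canonical_image B num) n (num n e) =
    Pair e ` out_edges B (Suc n) (rng B n e)"
  using assms by (auto simp: canonical_image_def out_edges_def num_eq_iff)

lemma verts_canonical_image: "verts (canonical_image B num) n = num n ` edges B n"
  by (simp add: canonical_image_def)

lemma finite_in_edges_canonical_image:
  assumes "v \<in> verts (canonical_image B num) (Suc n)"
  shows "finite (in_edges (canonical_image B num) n v)"
  using assms finite_in_edges src_in_verts
  by (auto simp: verts_canonical_image in_edges_canonical_image)

section \<open>Row and column sums of the image\<close>

text \<open>An edge of level \<open>Suc n\<close> has its source at level \<open>Suc n\<close>, and
  the edges entering it belong to level \<open>n\<close>; hence the index of \<open>r\<close> is
  unchanged.\<close>

lemma ERS_canonical_image: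
  assumes "ERS B r"
  shows "ERS (canonical_image B num) r"
proof -
  have "card (in_edges B n v) = r n" if "v \<in> verts B (Suc n)" for n v
    using assms that by (simp add: ERS_iff_card_in_edges src_in_verts finite_in_edges)
  moreover have "ERS (canonical_image B num) r \<longleftrightarrow>
      (\<forall>n. \<forall>v\<in>verts (canonical_image B num) (Suc n).
        card (in_edges (canonical_image B num) n v) = r n)"
    by (intro ERS_iff_card_in_edges finite_in_edges_canonical_image) (auto simp: canonical_image_def)
  ultimately show ?thesis
    by (auto simp: verts_canonical_image in_edges_canonical_image src_in_verts card_image inj_on_def)
qed

text \<open>An edge of level \<open>n\<close> ends at level \<open>n + 1\<close>, and the edges
  leaving that vertex are counted by \<open>c (n + 1)\<close>; hence the shift.\<close>

lemma ECS_canonical_image: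
  assumes "ECS B c"
  shows "ECS (canonical_image B num) (\<lambda>n. c (n + 1))"
proof -
  have "finite (out_edges B n w) \<and> card (out_edges B n w) = c n" if "w \<in> verts B n" for n w
    using assms that by (simp add: ECS_iff_card_out_edges rng_in_verts finite_in_edges)
  moreover have "ECS (canonical_image B num) (\<lambda>n. c (n + 1)) \<longleftrightarrow>
      (\<forall>n. \<forall>w\<in>verts (canonical_image B num) n.
        finite (out_edges (canonical_image B num) n w) \<and>
        card (out_edges (canonical_image B num) n w) = c (n + 1))"
    by (intro ECS_iff_card_out_edges finite_in_edges_canonical_image) (auto simp: canonical_image_def)
  ultimately show ?thesis
    by (auto simp: verts_canonical_image out_edges_canonical_image rng_in_verts card_image inj_on_def)
qed

section \<open>Stationarity of the image\<close>

text \<open>This reduces the comparison of vertex sets of different levels to a comparison of block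
  bounds.\<close>

lemma verts_canonical_image_blocks:
  "verts (canonical_image B num) n =
    (\<Union>l\<in>verts B (Suc n). {first_num B n l..last_num B n l})"
proof -
  have "edges B n = (\<Union>l\<in>verts B (Suc n). in_edges B n l)"
    using rng_in_verts by (auto simp: in_edges_def)
  then have "num n ` edges B n = (\<Union>l\<in>verts B (Suc n). num n ` in_edges B n l)" by blast
  then show ?thesis using num_bij_betw by (simp add: verts_canonical_image bij_betw_def)
qed

lemma incidence_eq_0:
  assumes "v \<notin> verts B (Suc n) \<or> w \<notin> verts B n"
  shows "incidence B n v w = 0"
proof -
  have "{e \<in> edges B n. src B n e = w \<and> rng B n e = v} = {}"
    using assms src_in_verts rng_in_verts by auto
  then show ?thesis unfolding incidence_def by (simp only: card.empty)
qed

lemma incidence_eq_card_fibre: "incidence B n v w = card {e \<in> in_edges B n v. src B n e = w}"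
  by (auto simp: incidence_def in_edges_def intro!: arg_cong[where f = card])

text \<open>Both cardinalities are the sum of the same row. Summing over \<open>UNIV\<close> gives
  the two levels a common index set.\<close>

lemma card_in_edges_eq:
  assumes "\<And>v w. incidence B m v w = incidence B n v w"
    and v: "v \<in> verts B (Suc m)" "v \<in> verts B (Suc n)"
  shows "card (in_edges B m v) = card (in_edges B n v)"
proof -
  have sum_iff: "((\<lambda>w. card {e \<in> in_edges B k v. src B k e = w}) has_sum s) UNIV \<longleftrightarrow>
      finite (in_edges B k v) \<and> card (in_edges B k v) = s" if "v \<in> verts B (Suc k)" for k s
    using finite_in_edges[OF that] by (intro has_sum_card_fibres) auto
  moreover have "(\<lambda>w. card {e \<in> in_edges B m v. src B m e = w}) =
      (\<lambda>w. card {e \<in> in_edges B n v. src B n e = w})"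
    using assms(1) unfolding incidence_eq_card_fibre by blast
  ultimately show ?thesis
    using sum_iff[OF v(1), of "card (in_edges B m v)"] sum_iff[OF v(2), of "card (in_edges B m v)"]
      finite_in_edges[OF v(1)] by simp
qed

lemma stationary_canonical_image:
  assumes "stationary B"
  shows "stationary (canonical_image B num)"
proof -
  have verts: "verts B m = verts B n" for m n
    using assms unfolding stationary_def by blast
  \<comment> \<open>\<open>stationary\<close> compares entries at vertices only; elsewhere both
    entries are 0.\<close>
  have inc: "incidence B m v w = incidence B n v w" for m n v w
  proof (cases "v \<in> verts B 0 \<and> w \<in> verts B 0")
    case True
    then show ?thesis using assms verts[of _ 0] unfolding stationary_def by metis
  next
    case False
    then show ?thesis using incidence_eq_0 verts[of _ 0] by metis
  qed
  \<comment> \<open>Stated for every integer \<open>v\<close>, since the block bounds are sums over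
    intervals of integers.\<close>
  have card: "card (in_edges B m v) = card (in_edges B n v)" for m n v
  proof (cases "v \<in> verts B 0")
    case True
    then show ?thesis using card_in_edges_eq[of m n v] inc verts[of _ 0] by metis
  next
    case False
    then have "in_edges B k v = {}" for k
      using rng_in_verts verts[of _ 0] by (auto simp: in_edges_def)
    then show ?thesis by simp
  qed
  have first: "first_num B m l = first_num B n l"
    and last: "last_num B m l = last_num B n l" for m n l
    by (simp_all only: first_num_def last_num_def card[of m _ n])
  have V: "verts (canonical_image B num) m = verts (canonical_image B num) n" for m n
    unfolding verts_canonical_image_blocks by (simp add: first[of m _ n] last[of m _ n] verts[of "Suc m" "Suc n"])
  \<comment> \<open>The blocks of the two levels coincide, so a common number determines a common
    range.\<close>
  have rng: "rng B m e = rng B n e'"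
    if "e \<in> edges B m" "e' \<in> edges B n" "num m e = num n e'" for m n e e'
    using num_in_block[OF that(1)] num_in_block[OF that(2)] that(3)
    by (metis block_eq first last)
  have src_le: "src B n e' \<le> src B m e"
    if e: "e \<in> edges B m" "e' \<in> edges B n" "num m e = num n e'" for m n e e'
  proof -
    define v where "v = rng B m e"
    have v: "v \<in> verts B (Suc m)" "v \<in> verts B (Suc n)"
      using rng_in_verts[OF e(1)] verts v_def by blast+
    show ?thesis
    proof (rule ordered_numberings_agree[where f = "src B m" and f' = "src B n"])
      show "bij_betw (num m) (in_edges B m v) {first_num B m v..last_num B m v}"
        using num_bij_betw[OF v(1)] .
      show "bij_betw (num n) (in_edges B n v) {first_num B m v..last_num B m v}"
        using num_bij_betw[OF v(2)] by (simp add: first[of m _ n] last[of m _ n])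
      show "card {x \<in> in_edges B m v. src B m x = z} = card {x \<in> in_edges B n v. src B n x = z}"
        for z using inc[of m v z n] by (simp only: incidence_eq_card_fibre)
      show "e \<in> in_edges B m v" "e' \<in> in_edges B n v"
        using e rng[OF e] by (simp_all add: in_edges_def v_def)
    qed (use num_mono[OF v(1)] num_mono[OF v(2)] e(3) in blast)+
  qed
  then have src: "src B m e = src B n e'"
    if "e \<in> edges B m" "e' \<in> edges B n" "num m e = num n e'" for m n e e'
    using that by (metis order_antisym)
  have "incidence (canonical_image B num) m v w = incidence (canonical_image B num) n v w"
    if vw: "v \<in> verts (canonical_image B num) (Suc n)" "w \<in> verts (canonical_image B num) n"
    for m n v w
  proof -
    obtain e e' where e: "e \<in> edges B n" "w = num n e" "e' \<in> edges B (Suc n)" "v = num (Suc n) e'"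
      using vw by (auto simp: verts_canonical_image)
    \<comment> \<open>The same labels also stand for edges \<open>d'\<close>, \<open>d\<close> of
      the levels \<open>Suc m\<close>, \<open>m\<close>; composability depends only on the source of
      one and the range of the other.\<close>
    have "v \<in> num (Suc m) ` edges B (Suc m)" "w \<in> num m ` edges B m"
      using vw V unfolding verts_canonical_image[symmetric] by blast+
    then obtain d d' where d: "d \<in> edges B m" "w = num m d" "d' \<in> edges B (Suc m)"
      "v = num (Suc m) d'" by auto
    have "rng B m d = rng B n e" "src B (Suc m) d' = src B (Suc n) e'"
      using rng[OF d(1) e(1)] src[OF d(3) e(3)] d e by auto
    then have "incidence (canonical_image B num) m (num (Suc m) d') (num m d) =
        incidence (canonical_image B num) n (num (Suc n) e') (num n e)"
      using d(1,3) e(1,3) by (simp add: incidence_canonical_image)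
    then show ?thesis using d e by simp
  qed
  with V show ?thesis unfolding stationary_def by blast
qed

section \<open>Branching from the absence of isolated paths\<close>

lemma ex_path: assumes "verts B 0 \<noteq> {}" shows "paths B \<noteq> {}"
proof -
  obtain w where "w \<in> verts B 0" using assms by blast
  then obtain e0 where e0: "e0 \<in> edges B 0"
    using out_edges_nonempty[of w 0] by (auto simp: out_edges_def)
  have "\<exists>x. \<forall>n. x n \<in> edges B n \<and> rng B n (x n) = src B (Suc n) (x (Suc n))"
  proof (rule dependent_nat_choice)
    show "\<exists>e. e \<in> edges B 0" using e0 by blast
    show "\<exists>e'. e' \<in> edges B (Suc n) \<and> rng B n e = src B (Suc n) e'" if "e \<in> edges B n" for e n
      using out_edges_nonempty[OF rng_in_verts[OF that]] by (auto simp: out_edges_def)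
  qed
  then show ?thesis by (auto simp: paths_def)
qed

text \<open>Without branching, the first edge determines the whole path, so a cylinder of length 1
  would be an open singleton.\<close>

lemma ex_branching:
  assumes "verts B 0 \<noteq> {}"
  shows "\<exists>n. \<exists>e\<in>edges B n. \<exists>e'\<in>edges B n. src B n e = src B n e' \<and> e \<noteq> e'"
proof (rule ccontr)
  assume "\<not> ?thesis"
  then have unique: "e = e'"
    if "e \<in> edges B n" "e' \<in> edges B n" "src B n e = src B n e'" for n e e'
    using that by blast
  obtain x where x: "x \<in> paths B" using ex_path[OF assms] by blast
  have "y = x" if "y \<in> cylinder B 1 x" for y
  proof
    fix n show "y n = x n"
    proof (induction n)
      case 0
      then show ?case using that by (simp add: cylinder_def)
    next
      case (Suc n)
      have y: "y \<in> paths B" using that by (simp add: cylinder_def)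
      then have "src B (Suc n) (y (Suc n)) = src B (Suc n) (x (Suc n))"
        using Suc x unfolding paths_def by (metis (mono_tags, lifting) mem_Collect_eq)
      then show ?case using x y by (intro unique[of _ "Suc n"]) (auto simp: paths_def)
    qed
  qed
  then have "cylinder B 1 x = {x}" using x by (auto simp: cylinder_def)
  then have "openin (path_topology B) {x}"
    using x unfolding path_topology_def
    by (intro topology_generated_by_Basis CollectI exI[of _ 1] exI[of _ x]) simp
  \<comment> \<open>\<open>openin_subset\<close> puts \<open>x\<close> into the
    \<open>topspace\<close>, where isolated points are excluded.\<close>
  then show False
    using graph openin_subset[of "path_topology B" "{x}"] unfolding bratteli_graph_def by blast
qed

section \<open>Horizontal stationarity\<close>

lemma ERS_first_num:
  assumes "verts B (Suc n) = UNIV" "ERS B r"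
  shows "first_num B n l = int (r n) * l"
proof -
  have card: "card (in_edges B n v) = r n" for v
    using assms by (simp add: ERS_iff_card_in_edges src_in_verts finite_in_edges)
  show ?thesis by (auto simp: first_num_def card)
qed

text \<open>Rows 0 and 1 of the image are indicators of the blocks of \<open>s\<close> and
  \<open>t\<close>. Since they differ by a shift by 1, \<open>r n * t = r n * s + 1\<close>, so
  \<open>r n\<close> divides 1.\<close>

lemma row_sum_one_if_horizontally_stationary:
  assumes univ: "\<And>n. verts B n = UNIV" and "ERS B r"
    and hs: "horizontally_stationary (canonical_image B num)"
  shows "r n = 1"
proof -
  have card: "card (in_edges B k v) = r k" for k v
    using assms by (simp add: ERS_iff_card_in_edges src_in_verts finite_in_edges)
  have pos: "0 < r n"
    using in_edges_nonempty[of 0 n] finite_in_edges[of 0 n] univ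
    by (simp add: card_gt_0_iff flip: card[of n 0])
  \<comment> \<open>Horizontal stationarity of the image makes every integer a vertex, hence the
    number of an edge.\<close>
  have surj: "\<exists>e\<in>edges B k. num k e = i" for k i
  proof -
    have "i \<in> num k ` edges B k"
      using hs unfolding horizontally_stationary_def verts_canonical_image by simp
    then show ?thesis by blast
  qed
  have block: "int (r n) * rng B n e \<le> num n e" "num n e < int (r n) * (rng B n e + 1)"
    if "e \<in> edges B n" for e
    using num_in_block[OF that] ERS_first_num[of n r] univ assms(2) card
    by (auto simp: last_num_eq algebra_simps)
  obtain e' where e': "e' \<in> edges B (Suc n)" "num (Suc n) e' = 0" using surj by blast
  obtain f' where f': "f' \<in> edges B (Suc n)" "num (Suc n) f' = 1" using surj by blast
  define s where "s = src B (Suc n) e'"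
  define t where "t = src B (Suc n) f'"
  have shift: "int (r n) * s \<le> i \<and> i < int (r n) * (s + 1) \<longleftrightarrow>
      int (r n) * t \<le> i + 1 \<and> i + 1 < int (r n) * (t + 1)" for i
  proof -
    obtain e where e: "e \<in> edges B n" "num n e = i" using surj by blast
    obtain f where f: "f \<in> edges B n" "num n f = i + 1" using surj by blast
    have "incidence (canonical_image B num) n 0 i = incidence (canonical_image B num) n 1 (i + 1)"
      using hs[unfolded horizontally_stationary_def, THEN conjunct2, rule_format, of n 0 i] by simp
    moreover have "incidence (canonical_image B num) n 0 i = (if s = rng B n e then 1 else 0)"
      using incidence_canonical_image[OF e(1) e'(1)] unfolding e(2) e'(2) s_def .
    moreover have "incidence (canonical_image B num) n 1 (i + 1) = (if t = rng B n f then 1 else 0)"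
      using incidence_canonical_image[OF f(1) f'(1)] unfolding f(2) f'(2) t_def .
    ultimately have "s = rng B n e \<longleftrightarrow> t = rng B n f" by (metis zero_neq_one)
    moreover have rng_iff: "rng B n d = l \<longleftrightarrow> int (r n) * l \<le> num n d \<and> num n d < int (r n) * (l + 1)"
      if "d \<in> edges B n" for d l
    proof
      assume "int (r n) * l \<le> num n d \<and> num n d < int (r n) * (l + 1)"
      then have "int (r n) * l < int (r n) * (rng B n d + 1)"
        "int (r n) * rng B n d < int (r n) * (l + 1)" using block[OF that] by linarith+
      then show "rng B n d = l" using pos by simp
    qed (use block[OF that] in auto)
    ultimately show ?thesis using rng_iff[OF e(1), of s] rng_iff[OF f(1), of t] unfolding e(2) f(2) by blast
  qed
  \<comment> \<open>Testing \<open>shift\<close> at the left end of the block of \<open>s\<close>,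
    then just before that of \<open>t\<close>, compares the left ends in both directions.\<close>
  have "int (r n) * t \<le> int (r n) * s + 1"
    using shift[of "int (r n) * s"] pos by (simp add: algebra_simps)
  moreover have "int (r n) * s \<le> int (r n) * t - 1"
    using shift[of "int (r n) * t - 1"] pos by (simp add: algebra_simps)
  ultimately have "int (r n) * (t - s) = 1" by (simp add: algebra_simps)
  then show ?thesis by (metis dvd_triv_left int_dvd_int_iff nat_dvd_1_iff_1 of_nat_1)
qed

text \<open>Row sums 1 make an edge determined by its range. Translation invariance of
  \<open>B\<close> then rules out the two edges with a common source given by
  \<open>ex_branching\<close>.\<close>

lemma not_horizontally_stationary_canonical_image:
  assumes hsB: "horizontally_stationary B" and "ERS B r"
  shows "\<not> horizontally_stationary (canonical_image B num)"
proof
  assume hs: "horizontally_stationary (canonical_image B num)"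
  have univ: "verts B n = UNIV" for n
    using hsB unfolding horizontally_stationary_def by blast
  have "r n = 1" for n
    using univ assms(2) hs by (rule row_sum_one_if_horizontally_stationary)
  then have "card (in_edges B n v) = 1" for n v
    using assms(2) univ by (simp add: ERS_iff_card_in_edges src_in_verts finite_in_edges)
  then have unique: "e = e'"
    if "e \<in> edges B n" "e' \<in> edges B n" "rng B n e = rng B n e'" for n e e'
  proof -
    have "e \<in> in_edges B n (rng B n e)" "e' \<in> in_edges B n (rng B n e)"
      using that by (simp_all add: in_edges_def)
    then show ?thesis
      using \<open>\<And>v n. card (in_edges B n v) = 1\<close> by (metis card_1_singletonE singletonD)
  qed
  have step: "incidence B n (i + 1) (j + 1) = incidence B n i j" for n i j
    using hsB unfolding horizontally_stationary_def by simp
  \<comment> \<open>The translation \<open>k\<close> chosen below may be negative, so the induction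
    runs in both directions.\<close>
  have shift: "incidence B n (i + k) (j + k) = incidence B n i j" for n i j k
  proof (induction k rule: int_induct[where k = 0])
    case (step1 k)
    then show ?case using step[of n "i + k" "j + k"] by (simp add: add.assoc)
  next
    case (step2 k)
    then show ?case using step[of n "i + (k - 1)" "j + (k - 1)"] by simp
  qed simp
  obtain n e e' where e: "e \<in> edges B n" "e' \<in> edges B n" "src B n e = src B n e'" "e \<noteq> e'"
    using ex_branching univ by blast
  \<comment> \<open>The translate of \<open>e'\<close> with the range of \<open>e\<close> must be \<open>e\<close>, so it has the source of \<open>e'\<close>.\<close>
  define k where "k = rng B n e - rng B n e'"
  \<comment> \<open>\<open>card\<close> is 0 on infinite sets, so an edge alone would not make the
    entry positive.\<close>
  have "finite {d \<in> edges B n. src B n d = src B n e' \<and> rng B n d = rng B n e'}"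
    by (rule finite_subset[OF _ finite_in_edges[of "rng B n e'" n]])
      (auto simp: in_edges_def univ)
  then have "0 < incidence B n (rng B n e') (src B n e')"
    using e(2) unfolding incidence_def card_gt_0_iff by auto
  then have "0 < incidence B n (rng B n e' + k) (src B n e' + k)"
    by (simp add: shift)
  then have "{d \<in> edges B n. src B n d = src B n e' + k \<and> rng B n d = rng B n e' + k} \<noteq> {}"
    unfolding incidence_def by (metis card.empty less_irrefl)
  then obtain d where d: "d \<in> edges B n" "src B n d = src B n e' + k" "rng B n d = rng B n e"
    by (auto simp: k_def)
  then have "k = 0" using unique[OF d(1) e(1)] e(3) by simp
  then show False using unique[OF e(1,2)] e(4) by (simp add: k_def)
qed

end

theorem proposition8p15:
  fixes B :: "'e bratteli"
    and num :: "nat \<Rightarrow> 'e \<Rightarrow> int"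
    and r c :: "nat \<Rightarrow> nat"
  assumes "standard_bratteli B \<or> generalized_bratteli B"
    and "canonical_numbering B num"
    and "\<And>n. 0 < r n"
    and "\<And>n. 0 < c n"
  shows "((ERS B r \<longrightarrow> ERS (canonical_image B num) r) \<and>
          (ECS B c \<longrightarrow> ECS (canonical_image B num) (\<lambda>n. c (n + 1)))) \<and>
         (stationary B \<longrightarrow> stationary (canonical_image B num)) \<and>
         (generalized_bratteli B \<and> horizontally_stationary B \<and> ERS B r \<longrightarrow>
            \<not> horizontally_stationary (canonical_image B num))"
proof -
  interpret numbered_bratteli B num
    using assms(1,2) by unfold_locales (auto simp: standard_bratteli_def generalized_bratteli_def)
  show ?thesis
    using ERS_canonical_image ECS_canonical_image stationary_canonical_image
      not_horizontally_stationary_canonical_image by blast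
qed

end
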